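(* Let $A(z)=a_2z^2+a_1z+a_0$ and $B(z)=b_2z^2+b_1z+b_0$ be complex polynomials of degree at most $2$, with $A$ not identically zero. Let $w$ be a weight function on the unit circle satisfying the Pearson-type equation $$\frac{w'(\theta)}{w(\theta)}=\frac{B(e^{i\theta})-ie^{i\theta}A'(e^{i\theta})}{A(e^{i\theta})},\qquad\text{equivalently}\qquad \frac{d}{d\theta}\big[A(e^{i\theta})w(\theta)\big]=B(e^{i\theta})w(\theta),$$ and $A(1)[w(2\pi)-w(0)]=0$. Then the Verblunsky coefficients $\alpha_n$ associated with $w$ satisfy, for all $n\ge2$, the non-linear difference equations $$[(n-1)\overline{a}_2+i\overline{b}_2]\,\alpha_n+[(n-1)\overline{a}_0-i\overline{b}_0]\,\alpha_{n-2}=-(n\overline{a}_1-\gamma_n\overline{a}_0-\overline{\gamma}_n\overline{a}_2)\,\frac{\alpha_{n-1}}{1-|\alpha_{n-1}|^2}$$ and $$[(n-1)\overline{a}_2+i\overline{b}_2]\,\frac{\alpha_n}{1-|\alpha_{n-1}|^2}+[(n-1)\overline{a}_0-i\overline{b}_0]\,\alpha_{n-2}$$ $$=-\Big\{[i\overline{b}_0-(n+1)\overline{a}_0]\,\alpha_{n-1}\overline{\alpha}_n-i\overline{b}_1+(n+1)\overline{a}_1-2\gamma_n\overline{a}_0\Big\}\,\frac{\alpha_{n-1}}{1-|\alpha_{n-1}|^2}.$$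
   Context: A weight function on the unit circle is a nonnegative integrable function $w$ on $[0,2\pi]$, positive almost everywhere, with inner product $\langle f,g\rangle=\int_0^{2\pi}f(e^{i\theta})\overline{g(e^{i\theta})}\,w(\theta)\,d\theta$. The monic orthogonal polynomials on the unit circle $\Phi_n$ ($n\ge0$) are the monic polynomials of degree $n$ with $\langle\Phi_n,z^k\rangle=0$ for $0\le k\le n-1$. The Verblunsky coefficients are $\alpha_{n-1}=-\overline{\Phi_n(0)}$ for $n\ge0$ (so $\alpha_{-1}=-1$). Set $\gamma_0=0$ and $\gamma_n=\sum_{j=0}^{n-1}\overline{\alpha}_j\alpha_{j-1}$ for $n\ge1$. The Pearson-type equation is understood in the sense that $\theta\mapsto A(e^{i\theta})w(\theta)$ is (extends to) an absolutely continuous function on $[0,2\pi]$ whose derivative equals $B(e^{i\theta})w(\theta)$ almost everywhere, and $A(1)[w(2\pi)-w(0)]$ denotes the difference of the values of this function at $2\pi$ and at $0$ (so $w$ itself may be unbounded near a zero of $A$). Here $A'$ is the derivative of $A$ with respect to $z$. *)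

theory Defs
  imports "HOL-Analysis.Analysis" "HOL-Computational_Algebra.Polynomial"
begin

text \<open>Weights are functions of the angle; what happens off \<open>[0, 2\<pi>]\<close> is irrelevant.
  Integrability is with respect to completed Lebesgue measure.\<close>

definition circle_weight :: "(real \<Rightarrow> real) \<Rightarrow> bool" where
  "circle_weight w \<longleftrightarrow>
     (\<forall>\<theta>\<in>{0..2*pi}. 0 \<le> w \<theta>) \<and>
     set_integrable lebesgue {0..2*pi} w \<and>
     (AE \<theta> in lebesgue. \<theta> \<in> {0..2*pi} \<longrightarrow> 0 < w \<theta>)"

definition circle_inner :: "(real \<Rightarrow> real) \<Rightarrow> (complex \<Rightarrow> complex) \<Rightarrow> (complex \<Rightarrow> complex) \<Rightarrow> complex" where
  "circle_inner w f g =
     (LINT \<theta>:{0..2*pi}|lebesgue. f (cis \<theta>) * cnj (g (cis \<theta>)) * complex_of_real (w \<theta>))"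

definition is_mopuc :: "(real \<Rightarrow> real) \<Rightarrow> nat \<Rightarrow> complex poly \<Rightarrow> bool" where
  "is_mopuc w n p \<longleftrightarrow>
     degree p = n \<and> lead_coeff p = 1 \<and>
     (\<forall>k<n. circle_inner w (poly p) (\<lambda>z. z ^ k) = 0)"

text \<open>For a weight in the sense of \<^const>\<open>circle_weight\<close> there is exactly one such polynomial
  for each \<open>n\<close>.\<close>

definition mopuc :: "(real \<Rightarrow> real) \<Rightarrow> nat \<Rightarrow> complex poly" where
  "mopuc w n = (THE p. is_mopuc w n p)"

text \<open>The index is an integer so that the initial value \<open>verblunsky w (-1) = -1\<close> is covered;
  indices below \<open>-1\<close> are meaningless.\<close>

definition verblunsky :: "(real \<Rightarrow> real) \<Rightarrow> int \<Rightarrow> complex" where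
  "verblunsky w k = - cnj (poly (mopuc w (nat (k + 1))) 0)"

definition verblunsky_gamma :: "(real \<Rightarrow> real) \<Rightarrow> nat \<Rightarrow> complex" where
  "verblunsky_gamma w n =
     (\<Sum>j<n. cnj (verblunsky w (int j)) * verblunsky w (int j - 1))"

definition abs_continuous_on_interval :: "real \<Rightarrow> real \<Rightarrow> (real \<Rightarrow> complex) \<Rightarrow> bool" where
  "abs_continuous_on_interval a b F \<longleftrightarrow>
     (\<forall>\<epsilon>>0. \<exists>\<delta>>0. \<forall>(I :: nat set) u v.
        finite I \<longrightarrow>
        (\<forall>i\<in>I. a \<le> u i \<and> u i \<le> v i \<and> v i \<le> b) \<longrightarrow>
        disjoint_family_on (\<lambda>i. {u i<..<v i}) I \<longrightarrow>
        (\<Sum>i\<in>I. v i - u i) < \<delta> \<longrightarrow>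
        (\<Sum>i\<in>I. cmod (F (v i) - F (u i))) < \<epsilon>)"

text \<open>The equation \<open>d/d\<theta> [A(e\<^sup>i\<^sup>\<theta>) w(\<theta>)] = B(e\<^sup>i\<^sup>\<theta>) w(\<theta>)\<close>. Here \<open>F\<close> is the absolutely
  continuous version of \<open>\<theta> \<mapsto> A(e\<^sup>i\<^sup>\<theta>) w(\<theta>)\<close>: a weight matters only up to null sets (and may be
  unbounded near zeros of \<open>A\<close>), so the two are only required to agree almost everywhere.
  By continuity \<open>F\<close> is determined on \<open>[0, 2\<pi>]\<close> by \<open>A\<close> and \<open>w\<close>, and \<open>F (2 * pi) - F 0\<close> is the
  boundary term \<open>A(1) [w(2\<pi>) - w(0)]\<close>.\<close>

definition pearson_on_circle ::
  "complex poly \<Rightarrow> complex poly \<Rightarrow> (real \<Rightarrow> real) \<Rightarrow> (real \<Rightarrow> complex) \<Rightarrow> bool" where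
  "pearson_on_circle A B w F \<longleftrightarrow>
     abs_continuous_on_interval 0 (2*pi) F \<and>
     (AE \<theta> in lebesgue. \<theta> \<in> {0..2*pi} \<longrightarrow>
        F \<theta> = poly A (cis \<theta>) * complex_of_real (w \<theta>)) \<and>
     (AE \<theta> in lebesgue. \<theta> \<in> {0..2*pi} \<longrightarrow>
        (F has_vector_derivative poly B (cis \<theta>) * complex_of_real (w \<theta>)) (at \<theta>))"

end

theory Submission
  imports Defs
begin

text \<open>Write \<open>\<langle>p, q\<rangle>\<close> for the inner product, \<open>\<Phi>\<^sub>n\<close> for the monic orthogonal polynomials and \<open>\<Phi>\<^sub>n\<^sup>*\<close> for the
  polynomial with reversed and conjugated coefficients. Two facts about the weight carry the proof.
  First, \<open>\<langle>\<cdot>, \<cdot>\<rangle>\<close> is definite and multiplication by \<open>z\<close> is isometric for it; this gives Szego's recurrence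
  \<open>\<Phi>\<^sub>n\<^sub>+\<^sub>1 = z \<Phi>\<^sub>n + \<Phi>\<^sub>n\<^sub>+\<^sub>1(0) \<Phi>\<^sub>n\<^sup>*\<close>, and comparing coefficients in it identifies \<open>\<gamma>\<^sub>n\<close> with the coefficient
  of \<open>z\<^sup>n\<^sup>-\<^sup>1\<close> in \<open>\<Phi>\<^sub>n\<close>. Second, integrating the derivative of \<open>A w p (cnj q)\<close> over the circle turns the Pearson
  equation and the vanishing boundary term into the relation
  \<open>\<langle>B p, q\<rangle> + \<i> \<langle>A z p', q\<rangle> - \<i> \<langle>A p, z q'\<rangle> = 0\<close> for all polynomials \<open>p\<close> and \<open>q\<close>
  (\<open>circle_inner_pearson\<close>). As the boundary function is merely absolutely continuous, this rests on the
  fundamental theorem of calculus for such functions (\<open>has_integral_deriv_abs_continuous\<close>).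

  Since \<open>A\<close> and \<open>B\<close> are quadratic, choosing \<open>p = \<Phi>\<^sub>n\<close> lets orthogonality kill all but a few
  edge coefficients in each of the three terms. The choice \<open>q = z \<Phi>\<^sub>n\<^sub>-\<^sub>1\<^sup>*\<close> gives the conjugate of the first
  difference equation (\<open>three_term_relation\<close>). The choice \<open>q = z \<Phi>\<^sub>n\<close> gives a relation free of
  \<open>\<alpha>\<^sub>n\<^sub>-\<^sub>2\<close> (\<open>two_term_relation\<close>); its conjugate, multiplied by \<open>\<alpha>\<^sub>n\<^sub>-\<^sub>1 / (1 - \<bar>\<alpha>\<^sub>n\<^sub>-\<^sub>1\<bar>\<^sup>2)\<close> and added to the first
  equation, is the second one.\<close>

section \<open>Absolutely continuous functions\<close>

text \<open>The definition of absolute continuity quantifies over families indexed by natural numbers.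
  Tagged divisions are sets of pairs, so the property is transported along an enumeration to
  an arbitrary finite index set.\<close>

lemma abs_continuous_on_interval_finite_sum:
  assumes "abs_continuous_on_interval a b F" and "\<epsilon> > 0"
  shows "\<exists>\<delta>>0. \<forall>(J :: 'i set) u v. finite J \<longrightarrow>
            (\<forall>j\<in>J. a \<le> u j \<and> u j \<le> v j \<and> v j \<le> b) \<longrightarrow>
            disjoint_family_on (\<lambda>j. {u j<..<v j}) J \<longrightarrow> (\<Sum>j\<in>J. v j - u j) < \<delta> \<longrightarrow>
            (\<Sum>j\<in>J. cmod (F (v j) - F (u j))) < \<epsilon>"
proof -
  obtain \<delta> where "\<delta> > 0" and \<delta>: "\<And>(I :: nat set) u v. \<lbrakk>finite I;
      \<forall>i\<in>I. a \<le> u i \<and> u i \<le> v i \<and> v i \<le> b; disjoint_family_on (\<lambda>i. {u i<..<v i}) I;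
      (\<Sum>i\<in>I. v i - u i) < \<delta>\<rbrakk> \<Longrightarrow> (\<Sum>i\<in>I. cmod (F (v i) - F (u i))) < \<epsilon>"
    using assms unfolding abs_continuous_on_interval_def by meson
  have "(\<Sum>j\<in>J. cmod (F (v j) - F (u j))) < \<epsilon>"
    if J: "finite J" "\<forall>j\<in>J. a \<le> u j \<and> u j \<le> v j \<and> v j \<le> b"
      "disjoint_family_on (\<lambda>j. {u j<..<v j}) J" "(\<Sum>j\<in>J. v j - u j) < \<delta>"
    for J :: "'i set" and u v
  proof -
    obtain e where e: "bij_betw e {0..<card J} J"
      using ex_bij_betw_nat_finite [OF \<open>finite J\<close>] by blast
    have sum_e: "(\<Sum>i\<in>{0..<card J}. g (e i)) = (\<Sum>j\<in>J. g j)" for g :: "'i \<Rightarrow> real"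
      by (rule sum.reindex_bij_betw [OF e])
    have "(\<Sum>i\<in>{0..<card J}. cmod (F (v (e i)) - F (u (e i)))) < \<epsilon>"
    proof (rule \<delta>)
      show "\<forall>i\<in>{0..<card J}. a \<le> u (e i) \<and> u (e i) \<le> v (e i) \<and> v (e i) \<le> b"
        using J(2) e bij_betwE by blast
      show "disjoint_family_on (\<lambda>i. {u (e i)<..<v (e i)}) {0..<card J}"
        using J(3) e unfolding disjoint_family_on_def bij_betw_def inj_on_def by blast
      show "(\<Sum>i\<in>{0..<card J}. v (e i) - u (e i)) < \<delta>"
        using J(4) sum_e [of "\<lambda>j. v j - u j"] by simp
    qed simp
    then show ?thesis
      using sum_e [of "\<lambda>j. cmod (F (v j) - F (u j))"] by simp
  qed
  with \<open>\<delta> > 0\<close> show ?thesis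
    by blast
qed

text \<open>With the gauge integral the fundamental theorem comes down to one estimate for each tagged
  interval. Change the integrand to \<open>0\<close> on the exceptional null
  set \<open>N\<close>. At a point outside \<open>N\<close> the gauge is small enough for the linear approximation of
  \<open>F\<close>, which costs at most a small multiple of the length of the interval. At a point of \<open>N\<close> the gauge
  stays inside an open set \<open>U \<supseteq> N\<close> of small measure, so the intervals tagged in \<open>N\<close> have small
  total length and, by absolute continuity, \<open>F\<close> varies little over them.\<close>

theorem has_integral_deriv_abs_continuous:
  fixes F :: "real \<Rightarrow> complex"
  assumes "a \<le> b" and AC: "abs_continuous_on_interval a b F" and N: "negligible N"
    and deriv: "\<And>x. x \<in> {a..b} - N \<Longrightarrow> (F has_vector_derivative f x) (at x within {a..b})"
  shows "(f has_integral (F b - F a)) {a..b}"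
proof (rule has_integral_spike [OF N])
  define g where "g x = (if x \<in> N then 0 else f x)" for x
  show "\<And>x. x \<in> {a..b} - N \<Longrightarrow> f x = g x"
    by (simp add: g_def)
  show "(g has_integral (F b - F a)) {a..b}"
    unfolding has_integral_real
  proof safe
    fix \<epsilon> :: real
    assume "\<epsilon> > 0"
    \<comment> \<open>The summand \<open>1\<close> keeps the denominator nonzero when \<open>a = b\<close>.\<close>
    define \<eta> where "\<eta> = \<epsilon> / (2 * (b - a + 1))"
    have "\<eta> > 0" and \<eta>: "\<eta> * (b - a) \<le> \<epsilon>/2"
      using \<open>\<epsilon> > 0\<close> \<open>a \<le> b\<close> by (simp_all add: \<eta>_def field_simps)
    obtain \<delta> where "\<delta> > 0" and \<delta>: "\<forall>(J :: (real \<times> real set) set) u v. finite J \<longrightarrow>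
        (\<forall>j\<in>J. a \<le> u j \<and> u j \<le> v j \<and> v j \<le> b) \<longrightarrow>
        disjoint_family_on (\<lambda>j. {u j<..<v j}) J \<longrightarrow> (\<Sum>j\<in>J. v j - u j) < \<delta> \<longrightarrow>
        (\<Sum>j\<in>J. cmod (F (v j) - F (u j))) < \<epsilon>/2"
      using abs_continuous_on_interval_finite_sum
        [where ?'i = "real \<times> real set", OF AC half_gt_zero [OF \<open>\<epsilon> > 0\<close>]]
      by (elim exE conjE) (rule that)
    obtain U where "open U" "N \<subseteq> U" and UN: "U - N \<in> lmeasurable" "measure lebesgue (U - N) < \<delta>"
    proof -
      obtain U where "open U" "N \<subseteq> U" and UN: "U - N \<in> lmeasurable"
          "emeasure lebesgue (U - N) < ennreal \<delta>"
        using sets_lebesgue_outer_open [OF negligible_imp_sets [OF N] \<open>\<delta> > 0\<close>] .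
      moreover have "measure lebesgue (U - N) < \<delta>"
        using UN by (simp add: emeasure_eq_measure2 ennreal_less_iff)
      ultimately show thesis
        using that by blast
    qed
    have "U = (U - N) \<union> N"
      using \<open>N \<subseteq> U\<close> by blast
    moreover have "(U - N) \<union> N \<in> lmeasurable"
      using UN(1) negligible_imp_measurable [OF N] by (rule fmeasurable.Un)
    moreover have "measure lebesgue ((U - N) \<union> N) < \<delta>"
      using UN N by (simp add: measure_Un_null_set negligible_iff_null_sets fmeasurableD del: Un_Diff_cancel2)
    ultimately have U: "U \<in> lmeasurable" "measure lebesgue U < \<delta>"
      by simp_all
    have "\<exists>r>0. (x \<in> N \<longrightarrow> ball x r \<subseteq> U) \<and> (x \<in> {a..b} - N \<longrightarrow>
        (\<forall>y\<in>{a..b}. norm (y-x) < r \<longrightarrow> norm (F y - F x - (y-x) *\<^sub>R f x) \<le> \<eta> * norm (y-x)))" for x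
    proof (cases "x \<in> N")
      case True
      then show ?thesis
        using openE [OF \<open>open U\<close> subsetD [OF \<open>N \<subseteq> U\<close> True]] by blast
    next
      case False
      then show ?thesis
        using deriv [of x, unfolded has_vector_derivative_def has_derivative_within_alt] \<open>\<eta> > 0\<close>
        by (cases "x \<in> {a..b}") (auto intro: exI [of _ 1])
    qed
    then obtain r where r: "\<And>x. r x > 0" "\<And>x. x \<in> N \<Longrightarrow> ball x (r x) \<subseteq> U"
        "\<And>x y. \<lbrakk>x \<in> {a..b} - N; y \<in> {a..b}; norm (y-x) < r x\<rbrakk>
           \<Longrightarrow> norm (F y - F x - (y-x) *\<^sub>R f x) \<le> \<eta> * norm (y-x)"
      by metis
    show "\<exists>\<gamma>. gauge \<gamma> \<and> (\<forall>p. p tagged_division_of {a..b} \<and> \<gamma> fine p \<longrightarrow>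
        norm ((\<Sum>(x, K)\<in>p. measure lborel K *\<^sub>R g x) - (F b - F a)) < \<epsilon>)"
    proof (rule exI, safe)
      show "gauge (\<lambda>x. ball x (r x))"
        using r(1) gauge_ball_dependent by blast
    next
      fix p
      assume p: "p tagged_division_of {a..b}" and fine: "(\<lambda>x. ball x (r x)) fine p"
      define lo hi :: "real \<times> real set \<Rightarrow> real" where "lo = (\<lambda>t. Inf (snd t))" and "hi = (\<lambda>t. Sup (snd t))"
      have "finite p"
        using p by blast
      have tag: "fst t \<in> snd t \<and> snd t = {lo t..hi t} \<and> lo t \<le> hi t \<and> a \<le> lo t \<and> hi t \<le> b
          \<and> {lo t..hi t} \<subseteq> ball (fst t) (r (fst t)) \<and> fst t \<in> {lo t..hi t}" if "t \<in> p" for t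
      proof -
        obtain x K where t: "t = (x,K)" by (cases t)
        obtain c d where K: "K = {c..d}"
          using tagged_division_ofD(4) [OF p, of x K] \<open>t \<in> p\<close> t by auto
        have "x \<in> K" "K \<subseteq> {a..b}" "K \<subseteq> ball x (r x)"
          using tagged_division_ofD(2,3) [OF p] that t fineD [OF fine] by blast+
        then show ?thesis
          using K t by (auto simp: lo_def hi_def)
      qed
      define p1 p2 where "p1 = {t \<in> p. fst t \<in> N}" and "p2 = {t \<in> p. fst t \<notin> N}"
      have p12: "p = p1 \<union> p2" "p1 \<inter> p2 = {}" and fin: "finite p1" "finite p2"
        using \<open>finite p\<close> by (auto simp: p1_def p2_def)
      let ?E = "\<lambda>t. measure lborel (snd t) *\<^sub>R g (fst t) - (F (hi t) - F (lo t))"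
      have sums: "F b - F a = (\<Sum>t\<in>p. F (hi t) - F (lo t))" "b - a = (\<Sum>t\<in>p. hi t - lo t)"
        using additive_tagged_division_1 [OF \<open>a \<le> b\<close> p, of F]
          additive_tagged_division_1 [OF \<open>a \<le> b\<close> p, of "\<lambda>x. x"]
        by (simp_all add: lo_def hi_def case_prod_unfold)
      have disj: "disjoint_family_on (\<lambda>t. {lo t<..<hi t}) p"
      proof -
        have "{lo s<..<hi s} \<inter> {lo t<..<hi t} = {}" if "s \<in> p" "t \<in> p" "s \<noteq> t" for s t
        proof -
          have "interior (snd s) \<inter> interior (snd t) = {}"
            using tagged_division_ofD(5) [OF p, of "fst s" "snd s" "fst t" "snd t"] that
            by (simp add: prod_eq_iff)
          moreover have "snd s = {lo s..hi s}" "snd t = {lo t..hi t}"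
            using tag that by simp_all
          ultimately show ?thesis
            by simp
        qed
        then show ?thesis
          by (simp add: disjoint_family_on_def)
      qed
      \<comment> \<open>The straddle estimate: subtract the linear approximations at the two end points.\<close>
      have good: "norm (?E t) \<le> \<eta> * (hi t - lo t)" if "t \<in> p2" for t
      proof -
        have "t \<in> p" and x: "fst t \<in> {a..b} - N"
          using that tag [of t] by (auto simp: p2_def)
        let ?x = "fst t" and ?u = "lo t" and ?v = "hi t"
        have "?u \<in> ball ?x (r ?x)" "?v \<in> ball ?x (r ?x)"
          using tag [OF \<open>t \<in> p\<close>] by (simp_all only: subset_eq, simp_all)
        then have uxv: "?u \<le> ?x" "?x \<le> ?v" "?u \<in> {a..b}" "?v \<in> {a..b}" "\<bar>?u - ?x\<bar> < r ?x" "\<bar>?v - ?x\<bar> < r ?x"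
          using tag [OF \<open>t \<in> p\<close>] by (auto simp: dist_real_def)
        have "measure lborel (snd t) = ?v - ?u" and "g ?x = f ?x"
          using tag [OF \<open>t \<in> p\<close>] x by (auto simp: g_def)
        then have "?E t = (F ?u - F ?x - (?u - ?x) *\<^sub>R f ?x) - (F ?v - F ?x - (?v - ?x) *\<^sub>R f ?x)"
          by (simp only:) (simp add: algebra_simps)
        then have "norm (?E t) \<le> norm (F ?u - F ?x - (?u - ?x) *\<^sub>R f ?x)
            + norm (F ?v - F ?x - (?v - ?x) *\<^sub>R f ?x)"
          by (simp only: norm_triangle_ineq4)
        also have "\<dots> \<le> \<eta> * norm (?u - ?x) + \<eta> * norm (?v - ?x)"
          using uxv by (intro add_mono r(3) [OF x]) auto
        also have "\<dots> = \<eta> * (?v - ?u)"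
          using uxv by (simp add: algebra_simps)
        finally show ?thesis .
      qed
      have bad: "(\<Sum>t\<in>p1. cmod (F (hi t) - F (lo t))) < \<epsilon>/2"
      proof (rule \<delta> [rule_format, OF fin(1)])
        show "\<And>t. t \<in> p1 \<Longrightarrow> a \<le> lo t \<and> lo t \<le> hi t \<and> hi t \<le> b"
          using tag by (simp add: p1_def)
        show disj1: "disjoint_family_on (\<lambda>t. {lo t<..<hi t}) p1"
          using disj p12(1) by (metis disjoint_family_on_mono Un_upper1)
        have "(\<Sum>t\<in>p1. hi t - lo t) = (\<Sum>t\<in>p1. measure lebesgue {lo t<..<hi t})"
          using tag by (intro sum.cong) (auto simp: p1_def)
        also have "\<dots> = measure lebesgue (\<Union>t\<in>p1. {lo t<..<hi t})"
        proof (rule measure_finite_Union [symmetric, OF fin(1) _ disj1])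
          show "emeasure lebesgue {lo t<..<hi t} \<noteq> \<infinity>" if "t \<in> p1" for t
            using tag [of t] that by (simp add: p1_def)
        qed auto
        also have "\<dots> \<le> measure lebesgue U"
        proof (rule measure_mono_fmeasurable [OF _ _ U(1)])
          show "(\<Union>t\<in>p1. {lo t<..<hi t}) \<subseteq> U"
            using tag r(2) unfolding p1_def by fastforce
        qed (use fin in auto)
        finally show "(\<Sum>t\<in>p1. hi t - lo t) < \<delta>"
          using U(2) by simp
      qed
      have "(\<Sum>(x, K)\<in>p. measure lborel K *\<^sub>R g x) - (F b - F a) = (\<Sum>t\<in>p. ?E t)"
        by (simp add: sums(1) sum_subtractf case_prod_unfold)
      also have "\<dots> = (\<Sum>t\<in>p1. ?E t) + (\<Sum>t\<in>p2. ?E t)"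
        using p12 fin by (simp add: sum.union_disjoint)
      finally have "norm ((\<Sum>(x, K)\<in>p. measure lborel K *\<^sub>R g x) - (F b - F a))
          \<le> (\<Sum>t\<in>p1. norm (?E t)) + (\<Sum>t\<in>p2. norm (?E t))"
        by (auto intro: order_trans [OF norm_triangle_ineq] add_mono norm_sum)
      moreover have "(\<Sum>t\<in>p1. norm (?E t)) = (\<Sum>t\<in>p1. cmod (F (hi t) - F (lo t)))"
        by (intro sum.cong) (auto simp: p1_def g_def norm_minus_commute)
      moreover have "(\<Sum>t\<in>p2. norm (?E t)) \<le> \<eta> * (b - a)"
      proof -
        have "(\<Sum>t\<in>p2. norm (?E t)) \<le> (\<Sum>t\<in>p2. \<eta> * (hi t - lo t))"
          using good by (rule sum_mono)
        also have "\<dots> \<le> (\<Sum>t\<in>p. \<eta> * (hi t - lo t))"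
          using \<open>finite p\<close> tag \<open>\<eta> > 0\<close> by (intro sum_mono2) (auto simp: p2_def)
        also have "\<dots> = \<eta> * (b - a)"
          by (simp add: sums(2) sum_distrib_left)
        finally show ?thesis .
      qed
      ultimately show "norm ((\<Sum>(x, K)\<in>p. measure lborel K *\<^sub>R g x) - (F b - F a)) < \<epsilon>"
        using bad \<eta> by linarith
    qed
  qed
qed

lemma abs_continuous_imp_continuous_on:
  assumes "abs_continuous_on_interval a b F"
  shows "continuous_on {a..b} F"
  unfolding continuous_on_iff
proof (intro ballI allI impI)
  fix x and \<epsilon> :: real
  assume x: "x \<in> {a..b}" and "\<epsilon> > 0"
  obtain \<delta> where "\<delta> > 0" and \<delta>: "\<forall>(J :: unit set) u v. finite J \<longrightarrow>
        (\<forall>j\<in>J. a \<le> u j \<and> u j \<le> v j \<and> v j \<le> b) \<longrightarrow>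
        disjoint_family_on (\<lambda>j. {u j<..<v j}) J \<longrightarrow> (\<Sum>j\<in>J. v j - u j) < \<delta> \<longrightarrow>
        (\<Sum>j\<in>J. cmod (F (v j) - F (u j))) < \<epsilon>"
    using abs_continuous_on_interval_finite_sum [where ?'i = unit, OF assms \<open>\<epsilon> > 0\<close>]
    by (elim exE conjE) (rule that)
  have "dist (F y) (F x) < \<epsilon>" if y: "y \<in> {a..b}" "dist y x < \<delta>" for y
    \<comment> \<open>The family consists of the single interval between \<open>x\<close> and \<open>y\<close>.\<close>
    using \<delta> [rule_format, of "{()}" "\<lambda>_. min x y" "\<lambda>_. max x y"] x y
    by (cases "x \<le> y") (auto simp: disjoint_family_on_def dist_norm min_def max_def norm_minus_commute)
  then show "\<exists>d>0. \<forall>y\<in>{a..b}. dist y x < d \<longrightarrow> dist (F y) (F x) < \<epsilon>"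
    using \<open>\<delta> > 0\<close> by blast
qed

text \<open>Both factors are bounded by some \<open>M\<close>, so the increments of the product are at most \<open>M\<close> times
  those of \<open>F\<close> plus \<open>M * L\<close> times the lengths; the two contributions get \<open>\<epsilon>/2\<close> each.\<close>

lemma abs_continuous_on_interval_mult_lipschitz:
  assumes AC: "abs_continuous_on_interval a b F" and H: "L-lipschitz_on {a..b} H"
  shows "abs_continuous_on_interval a b (\<lambda>x. F x * H x)"
  unfolding abs_continuous_on_interval_def
proof (intro allI impI)
  fix \<epsilon> :: real
  assume "\<epsilon> > 0"
  have "bounded (F ` {a..b})" "bounded (H ` {a..b})"
    using compact_imp_bounded compact_continuous_image compact_Icc
      abs_continuous_imp_continuous_on [OF AC] lipschitz_on_continuous_on [OF H] by blast+
  then have "bounded (F ` {a..b} \<union> H ` {a..b})"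
    by simp
  then obtain M where "M > 0" and M: "\<And>x. x \<in> {a..b} \<Longrightarrow> cmod (F x) \<le> M \<and> cmod (H x) \<le> M"
    unfolding bounded_pos by blast
  have "L \<ge> 0"
    using H by (rule lipschitz_on_nonneg)
  define \<eta> where "\<eta> = \<epsilon> / (2 * M)"
  have "\<eta> > 0" "M * \<eta> = \<epsilon>/2"
    using \<open>\<epsilon> > 0\<close> \<open>M > 0\<close> by (simp_all add: \<eta>_def)
  obtain \<delta> where "\<delta> > 0" and \<delta>: "\<forall>(J :: nat set) u v. finite J \<longrightarrow>
        (\<forall>j\<in>J. a \<le> u j \<and> u j \<le> v j \<and> v j \<le> b) \<longrightarrow>
        disjoint_family_on (\<lambda>j. {u j<..<v j}) J \<longrightarrow> (\<Sum>j\<in>J. v j - u j) < \<delta> \<longrightarrow>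
        (\<Sum>j\<in>J. cmod (F (v j) - F (u j))) < \<eta>"
    using abs_continuous_on_interval_finite_sum [where ?'i = nat, OF AC \<open>\<eta> > 0\<close>]
    by (elim exE conjE) (rule that)
  define K where "K = M * (L + 1)"
  have "K > 0"
    using \<open>M > 0\<close> \<open>L \<ge> 0\<close> by (simp add: K_def)
  define \<delta>' where "\<delta>' = min \<delta> (\<epsilon> / (2 * K))"
  have "\<delta>' > 0"
    using \<open>\<delta> > 0\<close> \<open>\<epsilon> > 0\<close> \<open>K > 0\<close> by (simp add: \<delta>'_def)
  have "M * L * \<delta>' \<le> \<epsilon>/2"
  proof -
    have "M * L * \<delta>' \<le> K * (\<epsilon> / (2 * K))"
      using \<open>M > 0\<close> \<open>L \<ge> 0\<close> \<open>\<delta>' > 0\<close> by (intro mult_mono) (auto simp: \<delta>'_def K_def)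
    then show ?thesis
      using \<open>K > 0\<close> by simp
  qed
  have bound: "(\<Sum>i\<in>I. cmod (F (v i) * H (v i) - F (u i) * H (u i))) < M * \<eta> + M * L * \<delta>'"
    if I: "finite I" "\<forall>i\<in>I. a \<le> u i \<and> u i \<le> v i \<and> v i \<le> b"
      "disjoint_family_on (\<lambda>i. {u i<..<v i}) I" "(\<Sum>i\<in>I. v i - u i) < \<delta>'" for I :: "nat set" and u v
  proof -
    have "cmod (F (v i) * H (v i) - F (u i) * H (u i)) \<le>
        M * cmod (F (v i) - F (u i)) + M * L * (v i - u i)" if "i \<in> I" for i
    proof -
      have uv: "u i \<in> {a..b}" "v i \<in> {a..b}" "u i \<le> v i"
        using I(2) that by force+
      have "F (v i) * H (v i) - F (u i) * H (u i)
          = H (v i) * (F (v i) - F (u i)) + F (u i) * (H (v i) - H (u i))"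
        by (simp add: algebra_simps)
      then have "cmod (F (v i) * H (v i) - F (u i) * H (u i))
          \<le> cmod (H (v i)) * cmod (F (v i) - F (u i)) + cmod (F (u i)) * cmod (H (v i) - H (u i))"
        by (simp only: norm_triangle_ineq flip: norm_mult)
      also have "\<dots> \<le> M * cmod (F (v i) - F (u i)) + M * (L * (v i - u i))"
        using M uv lipschitz_onD [OF H uv(2,1)] \<open>M > 0\<close>
        by (intro add_mono mult_mono) (auto simp: dist_norm)
      finally show ?thesis
        by (simp add: mult.assoc)
    qed
    then have "(\<Sum>i\<in>I. cmod (F (v i) * H (v i) - F (u i) * H (u i)))
        \<le> (\<Sum>i\<in>I. M * cmod (F (v i) - F (u i)) + M * L * (v i - u i))"
      by (rule sum_mono)
    also have "\<dots> = M * (\<Sum>i\<in>I. cmod (F (v i) - F (u i))) + M * L * (\<Sum>i\<in>I. v i - u i)"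
      by (simp add: sum.distrib sum_distrib_left)
    also have "\<dots> < M * \<eta> + M * L * \<delta>'"
    proof (rule add_less_le_mono)
      show "M * (\<Sum>i\<in>I. cmod (F (v i) - F (u i))) < M * \<eta>"
        using \<delta> [rule_format, of I u v] I \<open>M > 0\<close> by (simp add: \<delta>'_def)
      show "M * L * (\<Sum>i\<in>I. v i - u i) \<le> M * L * \<delta>'"
        using I(4) \<open>M > 0\<close> \<open>L \<ge> 0\<close> by (intro mult_left_mono) auto
    qed
    finally show ?thesis .
  qed
  show "\<exists>\<delta>>0. \<forall>(I :: nat set) u v. finite I \<longrightarrow>
      (\<forall>i\<in>I. a \<le> u i \<and> u i \<le> v i \<and> v i \<le> b) \<longrightarrow> disjoint_family_on (\<lambda>i. {u i<..<v i}) I \<longrightarrow>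
      (\<Sum>i\<in>I. v i - u i) < \<delta> \<longrightarrow> (\<Sum>i\<in>I. cmod (F (v i) * H (v i) - F (u i) * H (u i))) < \<epsilon>"
  proof (intro exI [of _ \<delta>'] conjI allI impI)
    fix I :: "nat set" and u v
    assume "finite I" "\<forall>i\<in>I. a \<le> u i \<and> u i \<le> v i \<and> v i \<le> b"
      "disjoint_family_on (\<lambda>i. {u i<..<v i}) I" "(\<Sum>i\<in>I. v i - u i) < \<delta>'"
    from bound [OF this] show "(\<Sum>i\<in>I. cmod (F (v i) * H (v i) - F (u i) * H (u i))) < \<epsilon>"
      using \<open>M * \<eta> = \<epsilon>/2\<close> \<open>M * L * \<delta>' \<le> \<epsilon>/2\<close> by linarith
  qed fact
qed

lemma C1_imp_lipschitz_on_Icc: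
  fixes H :: "real \<Rightarrow> complex"
  assumes deriv: "\<And>x. (H has_vector_derivative H' x) (at x)" and cont: "continuous_on {a..b} H'"
  obtains L where "L-lipschitz_on {a..b} H"
proof -
  have "bounded (H' ` {a..b})"
    using cont by (intro compact_imp_bounded compact_continuous_image compact_Icc)
  then obtain L where "L > 0" and L: "\<And>x. x \<in> {a..b} \<Longrightarrow> norm (H' x) \<le> L"
    unfolding bounded_pos by blast
  have "L-lipschitz_on {a..b} H"
  proof (rule lipschitz_onI)
    fix x y
    assume "x \<in> {a..b}" "y \<in> {a..b}"
    then show "dist (H x) (H y) \<le> L * dist x y"
      unfolding dist_norm
    proof (intro differentiable_bound [of "{a..b}" H "\<lambda>x t. t *\<^sub>R H' x" L])
      show "onorm (\<lambda>t. t *\<^sub>R H' z) \<le> L" if "z \<in> {a..b}" for z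
        using L [OF that] by (simp add: onorm_scaleR_left onorm_id)
    qed (use deriv in \<open>auto simp: has_vector_derivative_def intro: has_derivative_at_withinI\<close>)
  qed (use \<open>L > 0\<close> in simp)
  then show thesis by (rule that)
qed

section \<open>The inner product of a weight on the circle\<close>

lemma circle_weight_mult_integrable:
  assumes "circle_weight w" and f: "continuous_on UNIV f"
  shows "set_integrable lebesgue {0..2*pi} (\<lambda>\<theta>. f \<theta> * complex_of_real (w \<theta>))"
proof (rule absolutely_integrable_bounded_measurable_product [where h = "\<lambda>c r. c * complex_of_real r"])
  show "bilinear (\<lambda>c r. c * complex_of_real r)"
    unfolding bilinear_def by (auto intro!: linearI simp: algebra_simps scaleR_conv_of_real)
  show "f \<in> borel_measurable (lebesgue_on {0..2*pi})"
    using f by (intro continuous_imp_measurable_on_sets_lebesgue) (auto intro: continuous_on_subset)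
  show "bounded (f ` {0..2*pi})"
    using f by (intro compact_imp_bounded compact_continuous_image) (auto intro: continuous_on_subset)
qed (use assms(1) in \<open>auto simp: circle_weight_def\<close>)

lemma circle_inner_integrable:
  assumes "circle_weight w"
  shows "set_integrable lebesgue {0..2*pi}
    (\<lambda>\<theta>. poly p (cis \<theta>) * cnj (poly q (cis \<theta>)) * complex_of_real (w \<theta>))"
  by (rule circle_weight_mult_integrable [OF assms]) (intro continuous_intros)

lemma inj_on_cis: "inj_on cis {0..<2*pi}"
proof (rule inj_on_inverseI)
  fix t assume "t \<in> {0..<2*pi}"
  then show "Arg2pi (cis t) = t"
    by (intro Arg2pi_unique [of 1]) (auto simp: cis_conv_exp)
qed

text \<open>Definiteness: if the integral of \<open>\<bar>p\<bar>\<^sup>2 w\<close> vanishes, then \<open>p\<close> vanishes almost everywhere on the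
  circle, since \<open>w > 0\<close> almost everywhere; a nonzero polynomial has only finitely many zeros there.\<close>

lemma circle_inner_self_nonzero:
  assumes w: "circle_weight w" and "p \<noteq> 0"
  shows "circle_inner w (poly p) (poly p) \<noteq> 0"
proof
  assume "circle_inner w (poly p) (poly p) = 0"
  let ?f = "\<lambda>\<theta>. (cmod (poly p (cis \<theta>)))\<^sup>2 * w \<theta>"
  have eq: "poly p (cis \<theta>) * cnj (poly p (cis \<theta>)) * complex_of_real (w \<theta>) = complex_of_real (?f \<theta>)" for \<theta>
    by (simp only: complex_norm_square of_real_mult)
  have int: "set_integrable lebesgue {0..2*pi} ?f"
    using integrable_Re [OF circle_inner_integrable [OF w, of p p, unfolded set_integrable_def eq]]
    by (simp add: set_integrable_def)
  have "(LINT \<theta>:{0..2*pi}|lebesgue. ?f \<theta>) = 0"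
    using \<open>circle_inner w (poly p) (poly p) = 0\<close> unfolding circle_inner_def eq set_integral_complex_of_real
    by simp
  then have "AE \<theta> in lebesgue. indicator {0..2*pi} \<theta> *\<^sub>R ?f \<theta> = 0"
    using w int unfolding set_lebesgue_integral_def set_integrable_def circle_weight_def
    by (subst (asm) integral_nonneg_eq_0_iff_AE) (auto simp: indicator_def)
  moreover have "AE \<theta> in lebesgue. \<theta> \<in> {0..2*pi} \<longrightarrow> 0 < w \<theta>"
    using w by (simp add: circle_weight_def)
  ultimately have "AE \<theta> in lebesgue. \<theta> \<in> {0..<2*pi} \<longrightarrow> poly p (cis \<theta>) = 0"
    by eventually_elim (auto simp: indicator_def)
  then obtain N where "N \<in> null_sets lebesgue" and N: "{\<theta>. \<not> (\<theta> \<in> {0..<2*pi} \<longrightarrow> poly p (cis \<theta>) = 0)} \<subseteq> N"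
    unfolding eventually_ae_filter by auto
  have "finite (cis -` {z. poly p z = 0} \<inter> {0..<2*pi})"
    using poly_roots_finite [OF \<open>p \<noteq> 0\<close>] inj_on_cis by (rule finite_vimage_IntI)
  then have "negligible (N \<union> (cis -` {z. poly p z = 0} \<inter> {0..<2*pi}))"
    using \<open>N \<in> null_sets lebesgue\<close> by (simp add: negligible_iff_null_sets [symmetric] negligible_finite)
  moreover have "box 0 (2*pi) \<subseteq> N \<union> (cis -` {z. poly p z = 0} \<inter> {0..<2*pi})"
  proof
    fix \<theta>
    assume "\<theta> \<in> box 0 (2*pi)"
    then have "\<theta> \<in> {0..<2*pi}"
      by auto
    then show "\<theta> \<in> N \<union> (cis -` {z. poly p z = 0} \<inter> {0..<2*pi})"
      using N by (cases "poly p (cis \<theta>) = 0") auto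
  qed
  ultimately have "negligible (box 0 (2*pi))"
    by (rule negligible_subset)
  then show False
    using pi_gt_zero by (simp only: negligible_interval) auto
qed

text \<open>This weak form of the Pearson equation replaces the differential equation in all the algebra
  that follows. On the circle put \<open>H = p * cnj q\<close>; since \<open>d/d\<theta>\<close> acts as \<open>\<i> z d/dz\<close>, the derivative of
  \<open>F H\<close> is almost everywhere \<open>w\<close> times the combination of integrands below. Its integral is the
  boundary term, which vanishes because \<open>F\<close> and \<open>H\<close> take equal values at both ends.\<close>

lemma circle_inner_pearson:
  assumes w: "circle_weight w" and P: "pearson_on_circle A B w F" and "F (2*pi) = F 0"
  shows "circle_inner w (poly (B * p)) (poly q)
      + \<i> * circle_inner w (poly (A * pCons 0 (pderiv p))) (poly q)
      - \<i> * circle_inner w (poly (A * p)) (poly (pCons 0 (pderiv q))) = 0"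
proof -
  define H where "H \<theta> = poly p (cis \<theta>) * cnj (poly q (cis \<theta>))" for \<theta>
  define H' where "H' \<theta> = \<i> * (cis \<theta> * poly (pderiv p) (cis \<theta>)) * cnj (poly q (cis \<theta>))
      - \<i> * poly p (cis \<theta>) * cnj (cis \<theta> * poly (pderiv q) (cis \<theta>))" for \<theta>
  have cis: "(cis has_vector_derivative (\<i> * cis \<theta>)) (at \<theta>)" for \<theta>
    using has_derivative_cis [of "\<lambda>x. x" "\<lambda>x. x" \<theta> UNIV] by (simp add: has_vector_derivative_def)
  have poly_cis: "((\<lambda>\<theta>. poly r (cis \<theta>)) has_vector_derivative (\<i> * cis \<theta> * poly (pderiv r) (cis \<theta>))) (at \<theta>)"
    for r \<theta>
    using field_vector_diff_chain_at [OF cis poly_DERIV] by (simp add: o_def)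
  have H: "(H has_vector_derivative H' \<theta>) (at \<theta>)" for \<theta>
    unfolding H_def [abs_def] H'_def
    by (rule has_vector_derivative_eq_rhs [OF has_vector_derivative_mult
          [OF poly_cis has_vector_derivative_cnj [OF poly_cis]]]) (simp add: algebra_simps)
  have "continuous_on {0..2*pi} H'"
    unfolding H'_def by (intro continuous_intros)
  then obtain L where "L-lipschitz_on {0..2*pi} H"
    using C1_imp_lipschitz_on_Icc [OF H] by blast
  with P have AC: "abs_continuous_on_interval 0 (2*pi) (\<lambda>\<theta>. F \<theta> * H \<theta>)"
    unfolding pearson_on_circle_def by (blast intro: abs_continuous_on_interval_mult_lipschitz)
  let ?f = "\<lambda>\<theta>. (poly B (cis \<theta>) * H \<theta> + poly A (cis \<theta>) * H' \<theta>) * complex_of_real (w \<theta>)"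
  have "AE \<theta> in lebesgue. \<theta> \<in> {0..2*pi} \<longrightarrow> ((\<lambda>\<theta>. F \<theta> * H \<theta>) has_vector_derivative ?f \<theta>) (at \<theta>)"
    using P [unfolded pearson_on_circle_def, THEN conjunct2, THEN conjunct1]
      P [unfolded pearson_on_circle_def, THEN conjunct2, THEN conjunct2]
  proof eventually_elim
    case (elim \<theta>)
    show ?case
    proof
      assume "\<theta> \<in> {0..2*pi}"
      with elim show "((\<lambda>\<theta>. F \<theta> * H \<theta>) has_vector_derivative ?f \<theta>) (at \<theta>)"
        by (intro has_vector_derivative_eq_rhs [OF has_vector_derivative_mult [OF _ H]])
          (auto simp: algebra_simps)
    qed
  qed
  then obtain N where "N \<in> null_sets lebesgue"
    and N: "{\<theta>. \<not> (\<theta> \<in> {0..2*pi} \<longrightarrow> ((\<lambda>\<theta>. F \<theta> * H \<theta>) has_vector_derivative ?f \<theta>) (at \<theta>))} \<subseteq> N"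
    unfolding eventually_ae_filter by auto
  have "(?f has_integral (F (2*pi) * H (2*pi) - F 0 * H 0)) {0..2*pi}"
  proof (rule has_integral_deriv_abs_continuous [OF _ AC])
    show "negligible N"
      using \<open>N \<in> null_sets lebesgue\<close> by (simp add: negligible_iff_null_sets)
    show "((\<lambda>\<theta>. F \<theta> * H \<theta>) has_vector_derivative ?f \<theta>) (at \<theta> within {0..2*pi})"
      if "\<theta> \<in> {0..2*pi} - N" for \<theta>
      using that N by (blast intro: has_vector_derivative_at_within)
  qed simp
  then have zero: "(?f has_integral 0) {0..2*pi}"
    using \<open>F (2*pi) = F 0\<close> by (simp add: H_def cis_2pi)
  have f_eq: "?f = (\<lambda>\<theta>. poly (B * p) (cis \<theta>) * cnj (poly q (cis \<theta>)) * complex_of_real (w \<theta>)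
      + \<i> * (poly (A * pCons 0 (pderiv p)) (cis \<theta>) * cnj (poly q (cis \<theta>)) * complex_of_real (w \<theta>))
      - \<i> * (poly (A * p) (cis \<theta>) * cnj (poly (pCons 0 (pderiv q)) (cis \<theta>)) * complex_of_real (w \<theta>)))"
    by (rule ext) (simp add: H_def H'_def algebra_simps)
  note int = circle_inner_integrable [OF w]
  have "set_integrable lebesgue {0..2*pi} ?f"
    unfolding f_eq by (intro set_integral_diff set_integral_add set_integrable_mult_right int)
  have linear: "(LINT \<theta>:{0..2*pi}|lebesgue. f \<theta> + \<i> * g \<theta> - \<i> * h \<theta>)
      = (LINT \<theta>:{0..2*pi}|lebesgue. f \<theta>) + \<i> * (LINT \<theta>:{0..2*pi}|lebesgue. g \<theta>)
        - \<i> * (LINT \<theta>:{0..2*pi}|lebesgue. h \<theta>)"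
    if "set_integrable lebesgue {0..2*pi} f" "set_integrable lebesgue {0..2*pi} g"
      "set_integrable lebesgue {0..2*pi} h" for f g h :: "real \<Rightarrow> complex"
    using that by simp
  from \<open>set_integrable lebesgue {0..2*pi} ?f\<close> have "(LINT \<theta>:{0..2*pi}|lebesgue. ?f \<theta>) = 0"
    by (rule has_integral_unique [OF has_integral_set_lebesgue zero])
  also have "(LINT \<theta>:{0..2*pi}|lebesgue. ?f \<theta>) = circle_inner w (poly (B * p)) (poly q)
      + \<i> * circle_inner w (poly (A * pCons 0 (pderiv p))) (poly q)
      - \<i> * circle_inner w (poly (A * p)) (poly (pCons 0 (pderiv q)))"
    unfolding f_eq circle_inner_def
    by (rule linear [OF int int int])
  finally show ?thesis .
qed

section \<open>Orthogonal polynomials for a Toeplitz form\<close>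

text \<open>For \<open>p\<close> of degree \<open>n\<close> this is \<open>z\<^sup>n * cnj (p (1 / cnj z))\<close>, usually written \<open>p\<close> with a star. When
  \<open>p 0 = 0\<close> its degree drops below \<open>n\<close>.\<close>

definition szego_dual :: "complex poly \<Rightarrow> complex poly" where
  "szego_dual p = map_poly cnj (reflect_poly p)"

lemma coeff_szego_dual: "coeff (szego_dual p) k = (if k \<le> degree p then cnj (coeff p (degree p - k)) else 0)"
  by (simp add: szego_dual_def coeff_map_poly coeff_reflect_poly)

lemma degree_szego_dual_le: "degree (szego_dual p) \<le> degree p"
  by (rule degree_le) (simp add: coeff_szego_dual)

text \<open>An inner product on polynomials in which multiplication by \<open>z\<close> is isometric, so that its Gram
  matrix on monomials is a Toeplitz matrix. The whole theory of orthogonal polynomials on the unit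
  circle used here follows from these five rules.\<close>

locale toeplitz_form =
  fixes ip :: "complex poly \<Rightarrow> complex poly \<Rightarrow> complex"
  assumes ip_add_left: "ip (p + q) r = ip p r + ip q r"
    and ip_smult_left: "ip (smult c p) r = c * ip p r"
    and ip_cnj: "cnj (ip p q) = ip q p"
    and ip_shift: "ip (pCons 0 p) (pCons 0 q) = ip p q"
    and ip_definite: "p \<noteq> 0 \<Longrightarrow> ip p p \<noteq> 0"
begin

lemma ip_add_right: "ip r (p + q) = ip r p + ip r q"
  by (metis complex_cnj_add ip_add_left ip_cnj)

lemma ip_smult_right: "ip r (smult c p) = cnj c * ip r p"
  by (metis complex_cnj_mult ip_smult_left ip_cnj)

lemma ip_0_right [simp]: "ip r 0 = 0"
  using ip_smult_right [of r 0 0] by simp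

lemma ip_diff_left: "ip (p - q) r = ip p r - ip q r"
  using ip_add_left [of "p - q" q r] by simp

lemma ip_diff_right: "ip r (p - q) = ip r p - ip r q"
  using ip_add_right [of r "p - q" q] by simp

lemma ip_sum_right: "ip r (\<Sum>k\<in>I. f k) = (\<Sum>k\<in>I. ip r (f k))"
  by (induction I rule: infinite_finite_induct) (simp_all add: ip_add_right)

lemma ip_expand_right:
  assumes "degree q \<le> n"
  shows "ip p q = (\<Sum>k\<le>n. cnj (coeff q k) * ip p (monom 1 k))"
proof -
  have "ip p q = ip p (\<Sum>k\<le>n. monom (coeff q k) k)"
    using assms by (simp add: poly_as_sum_of_monoms')
  also have "\<dots> = (\<Sum>k\<le>n. ip p (smult (coeff q k) (monom 1 k)))"
    by (simp add: ip_sum_right smult_monom)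
  finally show ?thesis
    by (simp add: ip_smult_right)
qed

lemma ip_monom_shift: "ip (monom 1 (i + d)) (monom 1 (k + d)) = ip (monom 1 i) (monom 1 k)"
  by (induction d) (simp_all add: monom_Suc ip_shift)

lemma ip_monom_toeplitz:
  assumes "i + l = j + k"
  shows "ip (monom 1 i) (monom 1 k) = ip (monom 1 j) (monom 1 l)"
proof (cases "i \<le> j")
  case True
  then obtain d where "j = i + d"
    using le_Suc_ex by blast
  moreover from this assms have "l = k + d"
    by simp
  ultimately show ?thesis
    by (simp only: ip_monom_shift)
next
  case False
  then obtain d where "i = j + d"
    using le_Suc_ex nat_le_linear by blast
  moreover from this assms have "k = l + d"
    by simp
  ultimately show ?thesis
    by (simp only: ip_monom_shift)
qed

definition monic_orthogonal :: "nat \<Rightarrow> complex poly \<Rightarrow> bool" where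
  "monic_orthogonal n p \<longleftrightarrow> degree p = n \<and> coeff p n = 1 \<and> (\<forall>k<n. ip p (monom 1 k) = 0)"

lemma monic_orthogonal_ip_low:
  assumes P: "monic_orthogonal n P" and q: "\<And>k. k \<ge> n \<Longrightarrow> coeff q k = 0"
  shows "ip P q = 0"
proof -
  have "degree q \<le> n"
    using q by (simp add: degree_le)
  then have "ip P q = (\<Sum>k\<le>n. cnj (coeff q k) * ip P (monom 1 k))"
    by (rule ip_expand_right)
  also have "\<dots> = 0"
  proof (rule sum.neutral, rule ballI)
    fix k
    show "cnj (coeff q k) * ip P (monom 1 k) = 0"
      using P q by (cases "k < n") (simp_all add: monic_orthogonal_def)
  qed
  finally show ?thesis .
qed

lemma monic_orthogonal_ip:
  assumes P: "monic_orthogonal n P" and q: "degree q \<le> n"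
  shows "ip P q = cnj (coeff q n) * ip P P"
proof -
  have "ip P (q - smult (coeff q n) P) = 0"
  proof (rule monic_orthogonal_ip_low [OF P])
    fix k
    assume "k \<ge> n"
    then show "coeff (q - smult (coeff q n) P) k = 0"
      using P q by (cases "k = n") (auto simp: monic_orthogonal_def coeff_eq_0)
  qed
  then show ?thesis
    by (simp add: ip_diff_right ip_smult_right)
qed

lemma monic_orthogonal_unique:
  assumes P: "monic_orthogonal n P" and Q: "monic_orthogonal n Q"
  shows "P = Q"
proof -
  have low: "coeff (P - Q) k = 0" if "k \<ge> n" for k
    using P Q that by (cases "k = n") (auto simp: monic_orthogonal_def coeff_eq_0)
  have "ip P (P - Q) = 0" "ip Q (P - Q) = 0"
    using monic_orthogonal_ip_low [OF P low] monic_orthogonal_ip_low [OF Q low] by simp_all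
  then have "ip (P - Q) (P - Q) = 0"
    by (simp add: ip_diff_left)
  then show ?thesis
    using ip_definite [of "P - Q"] by auto
qed

lemma monic_orthogonal_ip_self_nonzero: "monic_orthogonal n P \<Longrightarrow> ip P P \<noteq> 0"
  by (rule ip_definite) (auto simp: monic_orthogonal_def)

text \<open>Reversing and conjugating the coefficients reflects the Toeplitz matrix in its antidiagonal:
  \<open>\<langle>z\<^sup>n\<^sup>-\<^sup>i, z\<^sup>k\<rangle> = \<langle>z\<^sup>n\<^sup>-\<^sup>k, z\<^sup>i\<rangle>\<close>.\<close>

lemma ip_szego_dual_monom:
  assumes "k \<le> degree p"
  shows "ip (szego_dual p) (monom 1 k) = cnj (ip p (monom 1 (degree p - k)))"
proof -
  let ?n = "degree p"
  have "cnj (ip (szego_dual p) (monom 1 k)) = (\<Sum>i\<le>?n. cnj (coeff (szego_dual p) i) * ip (monom 1 k) (monom 1 i))"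
    unfolding ip_cnj by (rule ip_expand_right [OF degree_szego_dual_le])
  also have "\<dots> = (\<Sum>i\<le>?n. coeff p (?n - i) * ip (monom 1 (?n - i)) (monom 1 (?n - k)))"
    using assms by (intro sum.cong refl arg_cong2 [where f = "(*)"] ip_monom_toeplitz)
      (auto simp: coeff_szego_dual)
  also have "\<dots> = (\<Sum>i\<le>?n. coeff p i * ip (monom 1 i) (monom 1 (?n - k)))"
    by (rule sum.reindex_bij_witness [of _ "\<lambda>i. ?n - i" "\<lambda>i. ?n - i"]) auto
  also have "\<dots> = cnj (\<Sum>i\<le>?n. cnj (coeff p i) * ip (monom 1 (?n - k)) (monom 1 i))"
    by (simp add: ip_cnj)
  also have "\<dots> = ip p (monom 1 (?n - k))"
    by (simp only: ip_expand_right [OF order_refl, symmetric] ip_cnj)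
  finally show ?thesis
    by (metis complex_cnj_cnj)
qed

text \<open>The dual of an orthogonal polynomial is orthogonal to \<open>z, \<dots>, z\<^sup>n\<close> instead of \<open>1, \<dots>, z\<^sup>n\<^sup>-\<^sup>1\<close>,
  so it reads off constant coefficients where the polynomial itself reads off top ones.\<close>

lemma ip_szego_dual:
  assumes P: "monic_orthogonal n P" and q: "degree q \<le> n"
  shows "ip (szego_dual P) q = cnj (coeff q 0) * ip P P"
proof -
  have deg: "degree P = n"
    using P by (simp add: monic_orthogonal_def)
  have "ip (szego_dual P) (monom 1 k) = (if k = 0 then ip P P else 0)" if "k \<le> n" for k
  proof (cases "k = 0")
    case True
    then show ?thesis
      using monic_orthogonal_ip [OF P, of "monom 1 n"] ip_szego_dual_monom [of 0 P]
      by (simp add: deg degree_monom_eq ip_cnj)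
  next
    case False
    then show ?thesis
      using P that by (simp add: ip_szego_dual_monom deg monic_orthogonal_def)
  qed
  then have "ip (szego_dual P) q = (\<Sum>k\<le>n. if k = 0 then cnj (coeff q k) * ip P P else 0)"
    unfolding ip_expand_right [OF q] by (intro sum.cong) auto
  then show ?thesis
    by simp
qed

text \<open>Szego's recurrence. Both \<open>z P\<close> and the dual of \<open>P\<close> are orthogonal to \<open>z, \<dots>, z\<^sup>n\<close>, and the
  dual is not orthogonal to \<open>1\<close>, so a suitable multiple of it repairs the one missing
  orthogonality. Existence of the orthogonal polynomials follows by induction.\<close>

lemma monic_orthogonal_Suc:
  assumes P: "monic_orthogonal n P"
  shows "monic_orthogonal (Suc n) (pCons 0 P + smult (- ip (pCons 0 P) 1 / ip P P) (szego_dual P))"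
    (is "monic_orthogonal _ ?Q")
  unfolding monic_orthogonal_def
proof (intro conjI allI impI)
  have deg: "degree P = n" and lead: "coeff P n = 1"
    using P by (simp_all add: monic_orthogonal_def)
  show Q: "coeff ?Q (Suc n) = 1"
    by (simp add: coeff_szego_dual deg lead)
  have "degree ?Q \<le> Suc n"
    using degree_szego_dual_le [of P] degree_pCons_le [of 0 P] deg by (intro degree_add_le) auto
  then show "degree ?Q = Suc n"
    using Q le_degree [of ?Q "Suc n"] by simp
  show "ip ?Q (monom 1 k) = 0" if "k < Suc n" for k
  proof (cases k)
    case 0
    then show ?thesis
      using monic_orthogonal_ip_self_nonzero [OF P] ip_szego_dual [OF P, of 1]
      by (simp add: ip_diff_left ip_smult_left)
  next
    case (Suc j)
    then have "ip (pCons 0 P) (monom 1 k) = 0"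
      using P that by (simp add: monom_Suc ip_shift monic_orthogonal_def)
    moreover have "ip (szego_dual P) (monom 1 k) = 0"
      using ip_szego_dual [OF P, of "monom 1 k"] Suc that by (simp add: degree_monom_eq)
    ultimately show ?thesis
      by (simp add: ip_diff_left ip_smult_left)
  qed
qed

lemma monic_orthogonal_exists: "\<exists>P. monic_orthogonal n P"
proof (induction n)
  case 0
  have "monic_orthogonal 0 1"
    by (simp add: monic_orthogonal_def)
  then show ?case by blast
next
  case (Suc n)
  then show ?case
    using monic_orthogonal_Suc by blast
qed

end

locale opuc = toeplitz_form +
  fixes \<Phi> :: "nat \<Rightarrow> complex poly"
  assumes \<Phi>: "monic_orthogonal n (\<Phi> n)"
begin

text \<open>In the usual notation \<open>h n\<close> is the squared norm of \<open>\<Phi>\<^sub>n\<close>, \<open>c n = \<Phi>\<^sub>n(0)\<close> is the negated conjugate of the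
  Verblunsky coefficient with index \<open>n - 1\<close>, and \<open>l n\<close> is the coefficient of \<open>z\<^sup>n\<^sup>-\<^sup>1\<close> in \<open>\<Phi>\<^sub>n\<close>, which
  turns out to be \<open>\<gamma>\<^sub>n\<close>. The shift by \<open>pCons\<close> makes \<open>l 0 = 0\<close>.\<close>

definition h :: "nat \<Rightarrow> complex" where "h n = ip (\<Phi> n) (\<Phi> n)"
definition c :: "nat \<Rightarrow> complex" where "c n = coeff (\<Phi> n) 0"
definition l :: "nat \<Rightarrow> complex" where "l n = coeff (pCons 0 (\<Phi> n)) n"

lemma degree_\<Phi> [simp]: "degree (\<Phi> n) = n" and lead_\<Phi> [simp]: "coeff (\<Phi> n) n = 1"
  using \<Phi> [of n] by (simp_all add: monic_orthogonal_def)

lemma h_nonzero: "h n \<noteq> 0"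
  unfolding h_def using \<Phi> by (rule monic_orthogonal_ip_self_nonzero)

lemma cnj_h [simp]: "cnj (h n) = h n"
  by (simp add: h_def ip_cnj)

theorem szego_recurrence: "\<Phi> (Suc n) = pCons 0 (\<Phi> n) + smult (c (Suc n)) (szego_dual (\<Phi> n))"
proof -
  obtain a where a: "\<Phi> (Suc n) = pCons 0 (\<Phi> n) + smult a (szego_dual (\<Phi> n))"
    using monic_orthogonal_unique [OF \<Phi> monic_orthogonal_Suc [OF \<Phi>]] by blast
  then have "c (Suc n) = a"
    by (simp add: c_def coeff_szego_dual)
  with a show ?thesis by simp
qed

text \<open>Compare the coefficients of \<open>z\<^sup>n\<close> in Szego's recurrence.\<close>

lemma l_Suc: "l (Suc n) = l n + c (Suc n) * cnj (c n)"
  unfolding l_def by (simp add: szego_recurrence coeff_szego_dual) (simp add: c_def)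

lemma l_eq_sum: "l n = (\<Sum>j<n. c (Suc j) * cnj (c j))"
  by (induction n) (simp_all add: l_Suc, simp add: l_def)

lemma coeff_\<Phi>_Suc_1: "coeff (\<Phi> (Suc n)) 1 = c n + c (Suc n) * cnj (l n)"
  by (subst szego_recurrence, cases n) (simp_all add: coeff_szego_dual l_def c_def)

lemma ip_\<Phi>_degree_le:
  assumes "degree g \<le> n"
  shows "ip (\<Phi> n) g = cnj (coeff g n) * h n"
  unfolding h_def using monic_orthogonal_ip [OF \<Phi> assms] .

text \<open>One degree beyond the range of orthogonality: subtracting a multiple of \<open>\<Phi>\<^sub>n\<^sub>+\<^sub>1\<close>, which is orthogonal to
  \<open>\<Phi>\<^sub>n\<close>, removes the top coefficient of \<open>g\<close> and changes the next one by \<open>l (n + 1)\<close>.\<close>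

lemma ip_\<Phi>_degree_le_Suc:
  assumes g: "degree g \<le> Suc n"
  shows "ip (\<Phi> n) g = (cnj (coeff g n) - cnj (coeff g (Suc n)) * cnj (l (Suc n))) * h n"
proof -
  let ?g = "g - smult (coeff g (Suc n)) (\<Phi> (Suc n))"
  have "degree ?g \<le> n"
  proof (rule degree_le, intro allI impI)
    fix k assume "n < k"
    then show "coeff ?g k = 0"
      using g by (cases "k = Suc n") (auto simp: coeff_eq_0)
  qed
  then have "ip (\<Phi> n) ?g = cnj (coeff ?g n) * h n"
    by (rule ip_\<Phi>_degree_le)
  moreover have "ip (\<Phi> n) (\<Phi> (Suc n)) = 0"
    using ip_\<Phi>_degree_le [of "\<Phi> n" "Suc n"] ip_cnj [of "\<Phi> (Suc n)" "\<Phi> n"]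
    by (simp add: coeff_eq_0)
  ultimately show ?thesis
    by (simp add: ip_diff_right ip_smult_right l_def)
qed

text \<open>By Szego's recurrence \<open>z \<Phi>\<^sub>n\<close> is a multiple of the dual of \<open>\<Phi>\<^sub>n\<close> up to \<open>\<Phi>\<^sub>n\<^sub>+\<^sub>1\<close>, which is orthogonal to \<open>g\<close>.\<close>

lemma ip_shift_\<Phi>:
  assumes g: "degree g \<le> n"
  shows "ip (pCons 0 (\<Phi> n)) g = - cnj (coeff g 0) * c (Suc n) * h n"
proof -
  have "ip (\<Phi> (Suc n)) g = 0"
    using ip_\<Phi>_degree_le [of g "Suc n"] g by (simp add: coeff_eq_0)
  then have "ip (pCons 0 (\<Phi> n)) g + c (Suc n) * ip (szego_dual (\<Phi> n)) g = 0"
    by (simp add: szego_recurrence ip_add_left ip_smult_left)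
  then show ?thesis
    using ip_szego_dual [OF \<Phi> g] by (simp add: h_def eq_neg_iff_add_eq_0 algebra_simps)
qed

text \<open>Szego's recurrence writes \<open>\<Phi>\<^sub>n\<^sub>+\<^sub>1\<close> as \<open>z \<Phi>\<^sub>n\<close> plus a multiple of the dual; pairing with \<open>z \<Phi>\<^sub>n\<close>, which
  differs from \<open>\<Phi>\<^sub>n\<^sub>+\<^sub>1\<close> by a polynomial of lower degree, gives the ratio of the norms.\<close>

lemma h_Suc: "h (Suc n) = h n * (1 - c (Suc n) * cnj (c (Suc n)))"
proof -
  have "h (Suc n) = ip (\<Phi> (Suc n)) (pCons 0 (\<Phi> n))"
    using ip_\<Phi>_degree_le [of "pCons 0 (\<Phi> n)" "Suc n"] degree_pCons_le [of 0 "\<Phi> n"] by simp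
  also have "\<dots> = h n + c (Suc n) * cnj (ip (pCons 0 (\<Phi> n)) (szego_dual (\<Phi> n)))"
    by (simp add: szego_recurrence ip_add_left ip_smult_left ip_shift ip_cnj h_def)
  also have "ip (pCons 0 (\<Phi> n)) (szego_dual (\<Phi> n)) = - c (Suc n) * h n"
    using ip_shift_\<Phi> [of "szego_dual (\<Phi> n)" n] degree_szego_dual_le [of "\<Phi> n"] by (simp add: coeff_szego_dual)
  finally show ?thesis
    by (simp add: algebra_simps)
qed

lemma c_defect_nonzero: "1 - c (Suc n) * cnj (c (Suc n)) \<noteq> 0"
  using h_Suc [of n] h_nonzero [of "Suc n"] by auto

text \<open>Here \<open>z \<Phi>\<^sub>n\<close>, whose product with the dual is known, removes the top coefficient; in the lemma after this
  one \<open>z \<Phi>\<^sub>n\<^sub>+\<^sub>1\<close> does the same one degree higher.\<close>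

lemma ip_szego_dual_degree_le_Suc:
  assumes g: "degree g \<le> Suc n"
  shows "ip g (szego_dual (\<Phi> n)) = (coeff g 0 - coeff g (Suc n) * c (Suc n)) * h n"
proof -
  let ?g = "g - smult (coeff g (Suc n)) (pCons 0 (\<Phi> n))"
  have "degree ?g \<le> n"
  proof (rule degree_le, intro allI impI)
    fix k assume "n < k"
    then show "coeff ?g k = 0"
      using g by (cases "k = Suc n") (auto simp: coeff_eq_0 coeff_pCons split: nat.split)
  qed
  then have "ip (szego_dual (\<Phi> n)) ?g = cnj (coeff ?g 0) * h n"
    using ip_szego_dual [OF \<Phi>] by (simp add: h_def)
  then have "ip ?g (szego_dual (\<Phi> n)) = coeff g 0 * h n"
    by (subst ip_cnj [symmetric]) simp
  moreover have "ip (pCons 0 (\<Phi> n)) (szego_dual (\<Phi> n)) = - c (Suc n) * h n"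
    using ip_shift_\<Phi> [of "szego_dual (\<Phi> n)" n] degree_szego_dual_le [of "\<Phi> n"] by (simp add: coeff_szego_dual)
  moreover have "ip ?g (szego_dual (\<Phi> n)) = ip g (szego_dual (\<Phi> n))
      - coeff g (Suc n) * ip (pCons 0 (\<Phi> n)) (szego_dual (\<Phi> n))"
    by (simp only: ip_diff_left ip_smult_left)
  ultimately show ?thesis
    by (simp add: algebra_simps)
qed

lemma ip_szego_dual_degree_le_Suc_Suc:
  assumes g: "degree g \<le> Suc (Suc n)"
  shows "ip g (szego_dual (\<Phi> n)) =
    (coeff g 0 - (coeff g (Suc n) - coeff g (Suc (Suc n)) * l (Suc n)) * c (Suc n)) * h n
    - coeff g (Suc (Suc n)) * c (Suc (Suc n)) * h (Suc n)"
proof -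
  let ?g = "g - smult (coeff g (Suc (Suc n))) (pCons 0 (\<Phi> (Suc n)))"
  have "degree ?g \<le> Suc n"
  proof (rule degree_le, intro allI impI)
    fix k assume "Suc n < k"
    then show "coeff ?g k = 0"
      using g by (cases "k = Suc (Suc n)") (auto simp: coeff_eq_0 coeff_pCons split: nat.split)
  qed
  then have "ip ?g (szego_dual (\<Phi> n)) = (coeff ?g 0 - coeff ?g (Suc n) * c (Suc n)) * h n"
    by (rule ip_szego_dual_degree_le_Suc)
  moreover have "ip (pCons 0 (\<Phi> (Suc n))) (szego_dual (\<Phi> n)) = - c (Suc (Suc n)) * h (Suc n)"
    using ip_shift_\<Phi> [of "szego_dual (\<Phi> n)" "Suc n"] degree_szego_dual_le [of "\<Phi> n"] by (simp add: coeff_szego_dual)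
  moreover have "ip ?g (szego_dual (\<Phi> n)) = ip g (szego_dual (\<Phi> n))
      - coeff g (Suc (Suc n)) * ip (pCons 0 (\<Phi> (Suc n))) (szego_dual (\<Phi> n))"
    by (simp only: ip_diff_left ip_smult_left)
  ultimately show ?thesis
    by (simp add: algebra_simps l_def)
qed

text \<open>Multiplication by a quadratic polynomial spreads \<open>\<Phi>\<^sub>n\<^sub>+\<^sub>1\<close> over \<open>1, z, z\<^sup>2\<close>; against \<open>z g\<close> one
  factor \<open>z\<close> cancels, which centres the three terms. The formula serves both for \<open>B\<close> with the test
  polynomial itself and for \<open>A\<close> with its derivative.\<close>

lemma ip_quadratic_mult_\<Phi>:
  assumes g: "degree g \<le> Suc n"
  shows "ip ([:a0, a1, a2:] * \<Phi> (Suc n)) (pCons 0 g) =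
    (a0 * (cnj (coeff g n) - cnj (coeff g (Suc n)) * cnj (l (Suc (Suc n))))
      + a1 * cnj (coeff g (Suc n)) - a2 * cnj (coeff g 0) * c (Suc (Suc n))) * h (Suc n)"
proof -
  have "[:a0, a1, a2:] * \<Phi> (Suc n) = smult a0 (\<Phi> (Suc n))
      + pCons 0 (smult a1 (\<Phi> (Suc n)) + smult a2 (pCons 0 (\<Phi> (Suc n))))"
    by simp
  then have "ip ([:a0, a1, a2:] * \<Phi> (Suc n)) (pCons 0 g) = a0 * ip (\<Phi> (Suc n)) (pCons 0 g)
      + a1 * ip (\<Phi> (Suc n)) g + a2 * ip (pCons 0 (\<Phi> (Suc n))) g"
    by (simp only: ip_add_left ip_smult_left ip_shift) simp
  moreover have "degree (pCons 0 g) \<le> Suc (Suc n)"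
    using g degree_pCons_le [of 0 g] by simp
  ultimately show ?thesis
    by (simp only: ip_\<Phi>_degree_le_Suc ip_\<Phi>_degree_le [OF g] ip_shift_\<Phi> [OF g] coeff_pCons_Suc)
      (simp add: algebra_simps)
qed

lemma quadratic_mult_pderiv_\<Phi>:
  fixes a0 a1 a2 :: complex and n :: nat
  defines "K \<equiv> [:a0, a1, a2:] * pderiv (\<Phi> (Suc n))"
  shows "degree K \<le> Suc (Suc n)" and "coeff K 0 = a0 * coeff (\<Phi> (Suc n)) 1"
    and "coeff K (Suc n) = of_nat (Suc n) * a1 + of_nat n * a2 * l (Suc n)"
    and "coeff K (Suc (Suc n)) = of_nat (Suc n) * a2"
proof -
  have K: "K = smult a0 (pderiv (\<Phi> (Suc n))) + pCons 0 (smult a1 (pderiv (\<Phi> (Suc n)))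
      + pCons 0 (smult a2 (pderiv (\<Phi> (Suc n)))))"
    by (simp add: K_def)
  show "degree K \<le> Suc (Suc n)"
    unfolding K by (rule degree_le) (auto simp: coeff_pCons coeff_pderiv coeff_eq_0 split: nat.split)
  show "coeff K 0 = a0 * coeff (\<Phi> (Suc n)) 1"
    by (simp add: K coeff_pderiv)
  show "coeff K (Suc n) = of_nat (Suc n) * a1 + of_nat n * a2 * l (Suc n)"
    by (cases n) (simp_all add: K coeff_pderiv coeff_eq_0 l_def)
  show "coeff K (Suc (Suc n)) = of_nat (Suc n) * a2"
    by (simp add: K coeff_pderiv coeff_eq_0)
qed

end

section \<open>Consequences of the Pearson relation\<close>

locale semiclassical_opuc = opuc +
  fixes a0 a1 a2 b0 b1 b2 :: complex
  assumes pearson: "ip ([:b0, b1, b2:] * p) q + \<i> * ip ([:a0, a1, a2:] * pCons 0 (pderiv p)) q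
    - \<i> * ip ([:a0, a1, a2:] * p) (pCons 0 (pderiv q)) = 0"
begin

text \<open>The Pearson relation for \<open>p = \<Phi>\<^sub>n\<^sub>+\<^sub>1\<close> and \<open>q = z g\<close>, with the two terms in which \<open>\<Phi>\<^sub>n\<^sub>+\<^sub>1\<close> is not
  differentiated evaluated by orthogonality. The factors \<open>n + 1\<close> and \<open>n + 2\<close> are the exponents of
  \<open>z\<close> in \<open>z g\<close>.\<close>

lemma pearson_\<Phi>:
  assumes g: "degree g \<le> Suc n"
  shows "\<i> * ip ([:a0, a1, a2:] * pderiv (\<Phi> (Suc n))) g =
    - ((b0 - \<i> * of_nat (Suc n) * a0) * cnj (coeff g n)
       + (b1 - \<i> * of_nat (Suc (Suc n)) * a1
          - (b0 - \<i> * of_nat (Suc (Suc n)) * a0) * cnj (l (Suc (Suc n)))) * cnj (coeff g (Suc n))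
       - (b2 - \<i> * a2) * cnj (coeff g 0) * c (Suc (Suc n))) * h (Suc n)"
proof -
  have deg: "degree (pderiv (pCons 0 g)) \<le> Suc n"
    using g degree_pCons_le [of 0 g] by (simp add: degree_pderiv)
  have "ip ([:a0, a1, a2:] * pCons 0 (pderiv (\<Phi> (Suc n)))) (pCons 0 g)
      = ip ([:a0, a1, a2:] * pderiv (\<Phi> (Suc n))) g"
    unfolding mult_pCons_right by (simp add: ip_shift)
  then show ?thesis
    using pearson [of "\<Phi> (Suc n)" "pCons 0 g"] ip_quadratic_mult_\<Phi> [OF g, of b0 b1 b2]
      ip_quadratic_mult_\<Phi> [OF deg, of a0 a1 a2]
    by (simp only: coeff_pderiv coeff_pCons_Suc) (simp add: algebra_simps)
qed

text \<open>The test polynomial \<open>g\<close> is the dual of \<open>\<Phi>\<^sub>n\<close>. Its coefficients at \<open>0\<close>, \<open>n\<close> and \<open>n + 1\<close> are \<open>1\<close>, \<open>cnj (c n)\<close>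
  and \<open>0\<close>, so the undifferentiated terms contribute exactly \<open>c (n + 2)\<close> and \<open>c n\<close>. The remaining term
  pairs \<open>A \<Phi>'\<^sub>n\<^sub>+\<^sub>1\<close> with the dual of \<open>\<Phi>\<^sub>n\<close>, to which only the coefficients of \<open>1\<close>, \<open>z\<^sup>n\<^sup>+\<^sup>1\<close> and \<open>z\<^sup>n\<^sup>+\<^sup>2\<close>
  contribute.\<close>

theorem three_term_relation:
  fixes n :: nat
  defines "D \<equiv> 1 - c (Suc n) * cnj (c (Suc n))"
  shows "(of_nat n * a2 - \<i> * b2) * c (Suc (Suc n)) * D + (of_nat n * a0 + \<i> * b0) * c n * D
    = - (of_nat (Suc n) * a1 - cnj (l (Suc n)) * a0 - l (Suc n) * a2) * c (Suc n)"
proof -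
  have "degree (szego_dual (\<Phi> n)) \<le> Suc n"
    using degree_szego_dual_le [of "\<Phi> n"] by simp
  note eq = pearson_\<Phi> [OF this] 
  note K = quadratic_mult_pderiv_\<Phi> [of a0 a1 a2 n]
  have ip_eq: "ip ([:a0, a1, a2:] * pderiv (\<Phi> (Suc n))) (szego_dual (\<Phi> n)) =
    (a0 * (c n + c (Suc n) * cnj (l n)) - (of_nat (Suc n) * a1 + of_nat n * a2 * l (Suc n)
         - of_nat (Suc n) * a2 * l (Suc n)) * c (Suc n)) * h n
      - of_nat (Suc n) * a2 * c (Suc (Suc n)) * (h n * D)"
    by (simp only: ip_szego_dual_degree_le_Suc_Suc [OF K(1)] K(2-4) coeff_\<Phi>_Suc_1 h_Suc D_def)
  have "\<i> * ((a0 * (c n + c (Suc n) * cnj (l n)) - (of_nat (Suc n) * a1 + of_nat n * a2 * l (Suc n)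
         - of_nat (Suc n) * a2 * l (Suc n)) * c (Suc n)) 
      - of_nat (Suc n) * a2 * c (Suc (Suc n)) * D) * h n
    = \<i> * ip ([:a0, a1, a2:] * pderiv (\<Phi> (Suc n))) (szego_dual (\<Phi> n))"
    unfolding ip_eq by (simp add: algebra_simps)
  also have "\<dots> = - ((b0 - \<i> * of_nat (Suc n) * a0) * c n
       - (b2 - \<i> * a2) * c (Suc (Suc n))) * D * h n"
    unfolding eq by (simp add: coeff_szego_dual h_Suc D_def flip: c_def)
  finally have "\<i> * ((a0 * (c n + c (Suc n) * cnj (l n)) - (of_nat (Suc n) * a1 + of_nat n * a2 * l (Suc n)
         - of_nat (Suc n) * a2 * l (Suc n)) * c (Suc n)) 
      - of_nat (Suc n) * a2 * c (Suc (Suc n)) * D) =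
    - ((b0 - \<i> * of_nat (Suc n) * a0) * c n
       - (b2 - \<i> * a2) * c (Suc (Suc n))) * D"
    by (rule iffD1 [OF mult_right_cancel [OF h_nonzero]])
  \<comment> \<open>Multiplication by \<open>- \<i>\<close> brings the equation into the form of the statement.\<close>
  from arg_cong [OF this, of "\<lambda>x. - \<i> * x"] show ?thesis
    by (simp add: l_Suc D_def algebra_simps)
qed

text \<open>The test polynomial \<open>g\<close> is \<open>\<Phi>\<^sub>n\<^sub>+\<^sub>1\<close> itself, so everything is a multiple of its squared norm, and
  \<open>c n\<close> does not enter.\<close>

lemma two_term_relation:
  "(of_nat n * a2 - \<i> * b2) * c (Suc (Suc n)) * cnj (c (Suc n))
    = (\<i> * b0 + of_nat (Suc (Suc n)) * a0) * c (Suc n) * cnj (c (Suc (Suc n)))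
      - \<i> * b1 - a1 + cnj (l (Suc n)) * a0 - l (Suc n) * a2"
proof -
  note K = quadratic_mult_pderiv_\<Phi> [of a0 a1 a2 n]
  have "ip ([:a0, a1, a2:] * pderiv (\<Phi> (Suc n))) (\<Phi> (Suc n))
      = cnj (ip (\<Phi> (Suc n)) ([:a0, a1, a2:] * pderiv (\<Phi> (Suc n))))"
    by (simp only: ip_cnj)
  also have "\<dots> = (of_nat (Suc n) * a1 + of_nat n * a2 * l (Suc n)
      - of_nat (Suc n) * a2 * l (Suc (Suc n))) * h (Suc n)"
    by (simp only: ip_\<Phi>_degree_le_Suc [OF K(1)] K(3,4)) simp
  finally have "\<i> * (of_nat (Suc n) * a1 + of_nat n * a2 * l (Suc n)
      - of_nat (Suc n) * a2 * l (Suc (Suc n))) * h (Suc n)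
    = \<i> * ip ([:a0, a1, a2:] * pderiv (\<Phi> (Suc n))) (\<Phi> (Suc n))"
    by simp
  also have "\<dots> = - ((b0 - \<i> * of_nat (Suc n) * a0) * cnj (l (Suc n))
       + (b1 - \<i> * of_nat (Suc (Suc n)) * a1
          - (b0 - \<i> * of_nat (Suc (Suc n)) * a0) * cnj (l (Suc (Suc n))))
       - (b2 - \<i> * a2) * cnj (c (Suc n)) * c (Suc (Suc n))) * h (Suc n)"
    by (subst pearson_\<Phi>) (simp_all add: l_def c_def)
  finally have "\<i> * (of_nat (Suc n) * a1 + of_nat n * a2 * l (Suc n)
      - of_nat (Suc n) * a2 * l (Suc (Suc n)))
    = - ((b0 - \<i> * of_nat (Suc n) * a0) * cnj (l (Suc n))
       + (b1 - \<i> * of_nat (Suc (Suc n)) * a1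
          - (b0 - \<i> * of_nat (Suc (Suc n)) * a0) * cnj (l (Suc (Suc n))))
       - (b2 - \<i> * a2) * cnj (c (Suc n)) * c (Suc (Suc n)))"
    by (rule iffD1 [OF mult_right_cancel [OF h_nonzero]])
  \<comment> \<open>Multiplication by \<open>- \<i>\<close> brings the equation into the form of the statement.\<close>
  from arg_cong [OF this, of "\<lambda>x. - \<i> * x"] show ?thesis
    by (simp add: l_Suc [of "Suc n"] algebra_simps)
qed

end

section \<open>The difference equations for Verblunsky coefficients\<close>

lemma toeplitz_form_circle_inner:
  assumes w: "circle_weight w"
  shows "toeplitz_form (\<lambda>p q. circle_inner w (poly p) (poly q))"
proof
  note int = circle_inner_integrable [OF w]
  fix p q r :: "complex poly" and c :: complex
  show "circle_inner w (poly (p + q)) (poly r) = circle_inner w (poly p) (poly r) + circle_inner w (poly q) (poly r)"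
    by (simp add: circle_inner_def distrib_right int)
  show "circle_inner w (poly (smult c p)) (poly r) = c * circle_inner w (poly p) (poly r)"
    by (simp add: circle_inner_def mult.assoc)
  show "cnj (circle_inner w (poly p) (poly q)) = circle_inner w (poly q) (poly p)"
    unfolding circle_inner_def set_lebesgue_integral_def Bochner_Integration.integral_cnj [symmetric]
    by (simp add: mult_ac del: Bochner_Integration.integral_cnj)
  have "cis \<theta> * x * cnj (cis \<theta> * y) = x * cnj y" for \<theta> x y
  proof -
    have "cis \<theta> * cnj (cis \<theta>) = 1"
      by (simp add: cis_cnj cis_mult)
    then show ?thesis
      by (metis (no_types) complex_cnj_mult mult.assoc mult.commute mult_1)
  qed
  then show "circle_inner w (poly (pCons 0 p)) (poly (pCons 0 q)) = circle_inner w (poly p) (poly q)"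
    by (simp only: circle_inner_def poly_pCons add_0_left)
  show "circle_inner w (poly p) (poly p) \<noteq> 0" if "p \<noteq> 0"
    using circle_inner_self_nonzero [OF w that] .
qed

lemma opuc_mopuc:
  assumes w: "circle_weight w"
  shows "opuc (\<lambda>p q. circle_inner w (poly p) (poly q)) (mopuc w)"
proof -
  interpret toeplitz_form "\<lambda>p q. circle_inner w (poly p) (poly q)"
    by (rule toeplitz_form_circle_inner [OF w])
  have "poly (monom 1 k) = (\<lambda>z :: complex. z ^ k)" for k
    by (rule ext) (simp add: poly_monom)
  then have iff: "is_mopuc w n p \<longleftrightarrow> monic_orthogonal n p" for n p
    by (auto simp: is_mopuc_def monic_orthogonal_def)
  show ?thesis
  proof
    fix n
    have "\<exists>!p. is_mopuc w n p"
      using monic_orthogonal_exists monic_orthogonal_unique unfolding iff by blast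
    then show "monic_orthogonal n (mopuc w n)"
      unfolding mopuc_def iff [symmetric] by (rule theI')
  qed
qed

text \<open>Eliminating between the two relations: since \<open>D = 1 - y * y'\<close>, the second hypothesis turns
  \<open>C2 * x * D\<close> in the first into \<open>C2 * x - M * y\<close>.\<close>

lemma divide_difference_equations:
  fixes x y z y' C0 C2 D G M :: complex
  assumes "D = 1 - y * y'" and "D \<noteq> 0"
    and three: "C2 * x * D + C0 * z * D = - G * y" and two: "C2 * x * y' = M"
  shows "C2 * x + C0 * z = - G * (y / D)" and "C2 * (x / D) + C0 * z = - (G - M) * (y / D)"
proof -
  have "(C2 * x + C0 * z) * D = - G * y"
    using three by (simp add: algebra_simps)
  then show "C2 * x + C0 * z = - G * (y / D)"
    using \<open>D \<noteq> 0\<close> by (simp add: field_simps)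
  have "C2 * x + C0 * z * D = (C2 * x * D + C0 * z * D) + (C2 * x * y') * y"
    by (simp add: \<open>D = 1 - y * y'\<close> algebra_simps)
  also have "\<dots> = - (G - M) * y"
    unfolding three two by (simp add: algebra_simps)
  finally show "C2 * (x / D) + C0 * z = - (G - M) * (y / D)"
    using \<open>D \<noteq> 0\<close> by (simp add: field_simps)
qed

theorem theorem2p4:
  fixes a0 a1 a2 b0 b1 b2 :: complex and A B :: "complex poly"
    and w :: "real \<Rightarrow> real" and F :: "real \<Rightarrow> complex"
    and \<alpha> :: "int \<Rightarrow> complex" and \<gamma> :: "nat \<Rightarrow> complex"
  assumes "A = [:a0, a1, a2:]" and "B = [:b0, b1, b2:]" and "A \<noteq> 0"
    and "circle_weight w"
    and "pearson_on_circle A B w F"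
    and "F (2 * pi) - F 0 = 0"
    and "\<alpha> = verblunsky w" and "\<gamma> = verblunsky_gamma w"
  shows "\<forall>n\<ge>2.
     ((of_nat n - 1) * cnj a2 + \<i> * cnj b2) * \<alpha> (int n)
         + ((of_nat n - 1) * cnj a0 - \<i> * cnj b0) * \<alpha> (int n - 2)
       = - (of_nat n * cnj a1 - \<gamma> n * cnj a0 - cnj (\<gamma> n) * cnj a2)
           * (\<alpha> (int n - 1) / (1 - (complex_of_real (cmod (\<alpha> (int n - 1))))\<^sup>2))
     \<and>
     ((of_nat n - 1) * cnj a2 + \<i> * cnj b2)
           * (\<alpha> (int n) / (1 - (complex_of_real (cmod (\<alpha> (int n - 1))))\<^sup>2))
         + ((of_nat n - 1) * cnj a0 - \<i> * cnj b0) * \<alpha> (int n - 2)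
       = - ((\<i> * cnj b0 - (of_nat n + 1) * cnj a0) * \<alpha> (int n - 1) * cnj (\<alpha> (int n))
             - \<i> * cnj b1 + (of_nat n + 1) * cnj a1 - 2 * \<gamma> n * cnj a0)
           * (\<alpha> (int n - 1) / (1 - (complex_of_real (cmod (\<alpha> (int n - 1))))\<^sup>2))"
proof (intro allI impI)
  fix n :: nat
  assume "n \<ge> 2"
  then obtain k where n: "n = Suc k"
    by (cases n) auto
  then have of_nat_n: "of_nat n = (of_nat k + 1 :: complex)"
    by simp
  note w = \<open>circle_weight w\<close>
  interpret semiclassical_opuc "\<lambda>p q. circle_inner w (poly p) (poly q)" "mopuc w" a0 a1 a2 b0 b1 b2
  proof (intro semiclassical_opuc.intro opuc_mopuc [OF w] semiclassical_opuc_axioms.intro)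
    fix p q
    show "circle_inner w (poly ([:b0, b1, b2:] * p)) (poly q)
        + \<i> * circle_inner w (poly ([:a0, a1, a2:] * pCons 0 (pderiv p))) (poly q)
        - \<i> * circle_inner w (poly ([:a0, a1, a2:] * p)) (poly (pCons 0 (pderiv q))) = 0"
      using circle_inner_pearson [OF w, of A B F p q] assms(1,2,5,6) by simp
  qed
  have verblunsky: "verblunsky w (int j - 1) = - cnj (c j)" for j
    by (simp add: verblunsky_def c_def poly_0_coeff_0)
  have \<alpha>: "\<alpha> (int n) = - cnj (c (Suc (Suc k)))" "\<alpha> (int n - 1) = - cnj (c (Suc k))"
      "\<alpha> (int n - 2) = - cnj (c k)"
    using verblunsky [of "Suc (Suc k)"] verblunsky [of "Suc k"] verblunsky [of k]
    by (simp_all add: n \<open>\<alpha> = verblunsky w\<close> algebra_simps)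
  have \<gamma>: "\<gamma> n = l (Suc k)"
  proof -
    have "verblunsky w (int j) = - cnj (c (Suc j))" for j
      using verblunsky [of "Suc j"] by simp
    then show ?thesis
      by (simp add: \<open>\<gamma> = verblunsky_gamma w\<close> verblunsky_gamma_def verblunsky l_eq_sum n)
  qed
  define D where "D = 1 - c (Suc k) * cnj (c (Suc k))"
  have D: "1 - (complex_of_real (cmod (\<alpha> (int n - 1))))\<^sup>2 = D"
    by (simp add: \<alpha> D_def complex_norm_square flip: of_real_power)
  have "D \<noteq> 0" and "cnj D = D"
    using c_defect_nonzero [of k] by (simp_all add: D_def)
  define C2 where "C2 = (of_nat n - 1) * cnj a2 + \<i> * cnj b2"
  define C0 where "C0 = (of_nat n - 1) * cnj a0 - \<i> * cnj b0"
  define G where "G = of_nat n * cnj a1 - \<gamma> n * cnj a0 - cnj (\<gamma> n) * cnj a2"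
  define M where "M = - ((\<i> * cnj b0 - (of_nat n + 1) * cnj a0) * \<alpha> (int n - 1) * cnj (\<alpha> (int n)))
      + \<i> * cnj b1 - cnj a1 + \<gamma> n * cnj a0 - cnj (\<gamma> n) * cnj a2"
  have three: "C2 * \<alpha> (int n) * D + C0 * \<alpha> (int n - 2) * D = - G * \<alpha> (int n - 1)"
    using arg_cong [OF three_term_relation [of k, folded D_def], of "\<lambda>x. - cnj x"]
    by (simp add: \<alpha> \<gamma> C2_def C0_def G_def of_nat_n \<open>cnj D = D\<close> algebra_simps)
  have two: "C2 * \<alpha> (int n) * cnj (\<alpha> (int n - 1)) = M"
    using arg_cong [OF two_term_relation [of k], of cnj]
    by (simp add: \<alpha> \<gamma> C2_def M_def of_nat_n algebra_simps)
  have "D = 1 - \<alpha> (int n - 1) * cnj (\<alpha> (int n - 1))"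
    by (simp add: \<alpha> D_def)
  note eqs = divide_difference_equations [OF this \<open>D \<noteq> 0\<close> three two]
  have "G - M = (\<i> * cnj b0 - (of_nat n + 1) * cnj a0) * \<alpha> (int n - 1) * cnj (\<alpha> (int n))
      - \<i> * cnj b1 + (of_nat n + 1) * cnj a1 - 2 * \<gamma> n * cnj a0"
    by (simp add: G_def M_def algebra_simps)
  with eqs show "((of_nat n - 1) * cnj a2 + \<i> * cnj b2) * \<alpha> (int n)
         + ((of_nat n - 1) * cnj a0 - \<i> * cnj b0) * \<alpha> (int n - 2)
       = - (of_nat n * cnj a1 - \<gamma> n * cnj a0 - cnj (\<gamma> n) * cnj a2)
           * (\<alpha> (int n - 1) / (1 - (complex_of_real (cmod (\<alpha> (int n - 1))))\<^sup>2))
     \<and>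
     ((of_nat n - 1) * cnj a2 + \<i> * cnj b2)
           * (\<alpha> (int n) / (1 - (complex_of_real (cmod (\<alpha> (int n - 1))))\<^sup>2))
         + ((of_nat n - 1) * cnj a0 - \<i> * cnj b0) * \<alpha> (int n - 2)
       = - ((\<i> * cnj b0 - (of_nat n + 1) * cnj a0) * \<alpha> (int n - 1) * cnj (\<alpha> (int n))
             - \<i> * cnj b1 + (of_nat n + 1) * cnj a1 - 2 * \<gamma> n * cnj a0)
           * (\<alpha> (int n - 1) / (1 - (complex_of_real (cmod (\<alpha> (int n - 1))))\<^sup>2))"
    unfolding D C2_def C0_def G_def by simp
qed

end
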